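(* Let $\Pi$ be a Gibbs partition with parameters $(\alpha,V)$, let $n\ge 1$, and let $K_n$ and $(N_1,\dots,N_{K_n})$ be the number of blocks and the sizes of the blocks, in exchangeable random order, of the restriction $\Pi_n$ of $\Pi$ to $[n]$. Then for all integers $r\geq 1$, $k$, and $n_1,\dots,n_r\ge 1$ with $0\le k-r\le n-\sum_{j=1}^r n_j$, $$\mathbb{P}(N_1=n_1,\dots,N_r=n_r,K_n=k)=\frac{n!}{\prod_{j=1}^r n_j!}\prod_{j=1}^r(1-\alpha)_{n_j-1}\,\frac{V_{n,k}}{k!}\sum_{(b_1,\dots,b_{k-r})}\frac{1}{\prod_{i=1}^{k-r} b_i!}\prod_{i=1}^{k-r}(1-\alpha)_{b_i-1},$$ where the sum is over all $(b_1,\dots,b_{k-r})$ of positive integers with $\sum_i b_i=n-\sum_{j=1}^r n_j$, and equivalently $$\mathbb{P}(N_1=n_1,\dots,N_r=n_r,K_n=k)=\frac{n!}{\prod_{j=1}^r n_j!\,(n-\sum_{j=1}^r n_j)!}\prod_{j=1}^r(1-\alpha)_{n_j-1}\,\frac{V_{n,k}}{k_{[r]}}\,S^{-1,-\alpha}_{n-\sum_{j=1}^r n_j,\;k-r}.$$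
   Context: Notation: $(x)_n=x(x+1)\cdots(x+n-1)$ (rising factorial, $(x)_0=1$); $x_{[n]}=x(x-1)\cdots(x-n+1)$ (falling factorial). Gibbs partition with parameters $(\alpha,V)$: $\alpha\in(-\infty,1)$ and $V=(V_{n,k})_{1\le k\le n}$ are nonnegative weights with $V_{1,1}=1$ and $V_{n,k}=(n-k\alpha)V_{n+1,k}+V_{n+1,k+1}$; $\Pi$ is the exchangeable random partition of the positive integers such that for every $n$ and every partition $\{A_1,\dots,A_k\}$ of $[n]=\{1,\dots,n\}$, the restriction $\Pi_n$ of $\Pi$ to $[n]$ satisfies $\mathbb{P}(\Pi_n=\{A_1,\dots,A_k\})=V_{n,k}\prod_{i=1}^k(1-\alpha)_{|A_i|-1}$. Exchangeable random order: given $\Pi_n$ with $K_n=k$ blocks, the blocks are listed in uniformly random order (independent of everything else), so for every composition $(n_1,\dots,n_k)$ of $n$, $$\mathbb{P}(N_1=n_1,\dots,N_{K_n}=n_k,K_n=k)=\frac{n!}{\prod_{j=1}^k n_j!}\frac{1}{k!}V_{n,k}\prod_{j=1}^k(1-\alpha)_{n_j-1}.$$ Generalized central Stirling numbers: $S^{-1,-\alpha}_{n,k}=\frac{n!}{k!}\sum_{(n_1,\dots,n_k)}\prod_{j=1}^k\frac{(1-\alpha)_{n_j-1}}{n_j!}$, the sum being over compositions of $n$ into $k$ positive parts ($S_{0,0}^{-1,-\alpha}=1$, $S_{n,0}^{-1,-\alpha}=0$ for $n\ge1$, and $S_{n,k}^{-1,-\alpha}=0$ for $k>n$). An empty sum over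 $(b_1,\dots,b_0)$ equals $1$ if $n=\sum_j n_j$ and $0$ otherwise. *)

theory Defs
  imports
    "HOL-Probability.Probability"
    "HOL-Library.Disjoint_Sets"
    "HOL-Combinatorics.Multiset_Permutations"
begin

definition falling :: "real \<Rightarrow> nat \<Rightarrow> real" where
  "falling x n = (\<Prod>i<n. x - real i)"

definition compositions :: "nat \<Rightarrow> nat \<Rightarrow> nat list set" where
  "compositions n k = {bs. length bs = k \<and> (\<forall>b\<in>set bs. 1 \<le> b) \<and> sum_list bs = n}"

text \<open>The generalized central Stirling number $S^{-1,-\alpha}_{n,k}$.\<close>

definition gen_stirling :: "real \<Rightarrow> nat \<Rightarrow> nat \<Rightarrow> real" where
  "gen_stirling \<alpha> n k =
     fact n / fact k *
       (\<Sum>bs\<in>compositions n k. \<Prod>b\<leftarrow>bs. pochhammer (1 - \<alpha>) (b - 1) / fact b)"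

text \<open>The boundary conventions for these numbers hold automatically: the only composition of
  length 0 is the empty list, with sum 0 and empty product 1.\<close>

lemma gen_stirling_0_0: "gen_stirling \<alpha> 0 0 = 1"
proof -
  have "compositions 0 0 = {[]}"
    by (auto simp: compositions_def)
  then show ?thesis
    by (simp add: gen_stirling_def)
qed

lemma gen_stirling_n_0: "n \<ge> 1 \<Longrightarrow> gen_stirling \<alpha> n 0 = 0"
proof -
  assume "n \<ge> 1"
  then have "compositions n 0 = {}"
    by (auto simp: compositions_def)
  then show ?thesis
    by (simp add: gen_stirling_def)
qed

lemma gen_stirling_less: "n < k \<Longrightarrow> gen_stirling \<alpha> n k = 0"
proof -
  assume "n < k"
  have "length bs \<le> sum_list bs" if "\<forall>b\<in>set bs. 1 \<le> b" for bs :: "nat list"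
    using that by (induction bs) auto
  with \<open>n < k\<close> have "compositions n k = {}"
    by (fastforce simp: compositions_def)
  then show ?thesis
    by (simp add: gen_stirling_def)
qed

definition restrict_partition :: "nat \<Rightarrow> nat set set \<Rightarrow> nat set set" where
  "restrict_partition n P = (\<lambda>A. A \<inter> {1..n}) ` P - {{}}"

text \<open>Partitions of the positive integers, with the \<open>\<sigma>\<close>-algebra generated by the
  restrictions to \<open>{1..n}\<close>.\<close>

definition partition_space :: "nat set set measure" where
  "partition_space =
     sigma {P. partition_on {1..} P}
       {{P. partition_on {1..} P \<and> restrict_partition n P = Q} | n Q. True}"

definition exchangeable_partition :: "'a measure \<Rightarrow> ('a \<Rightarrow> nat set set) \<Rightarrow> bool" where
  "exchangeable_partition M \<pi> \<longleftrightarrow>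
     \<pi> \<in> measurable M partition_space \<and>
     (\<forall>n \<sigma> Q. \<sigma> permutes {1..n} \<longrightarrow> partition_on {1..n} Q \<longrightarrow>
        measure M {\<omega>\<in>space M. restrict_partition n (\<pi> \<omega>) = (\<lambda>A. \<sigma> ` A) ` Q} =
        measure M {\<omega>\<in>space M. restrict_partition n (\<pi> \<omega>) = Q})"

definition gibbs_weights :: "real \<Rightarrow> (nat \<Rightarrow> nat \<Rightarrow> real) \<Rightarrow> bool" where
  "gibbs_weights \<alpha> V \<longleftrightarrow>
     (\<forall>n k. 1 \<le> k \<longrightarrow> k \<le> n \<longrightarrow> 0 \<le> V n k) \<and>
     V 1 1 = 1 \<and>
     (\<forall>n k. 1 \<le> k \<longrightarrow> k \<le> n \<longrightarrow>
        V n k = (real n - real k * \<alpha>) * V (n + 1) k + V (n + 1) (k + 1))"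

definition gibbs_partition ::
  "'a measure \<Rightarrow> real \<Rightarrow> (nat \<Rightarrow> nat \<Rightarrow> real) \<Rightarrow> ('a \<Rightarrow> nat set set) \<Rightarrow> bool" where
  "gibbs_partition M \<alpha> V \<pi> \<longleftrightarrow>
     \<alpha> < 1 \<and> gibbs_weights \<alpha> V \<and> exchangeable_partition M \<pi> \<and>
     (\<forall>n Q. 1 \<le> n \<longrightarrow> partition_on {1..n} Q \<longrightarrow>
        measure M {\<omega>\<in>space M. restrict_partition n (\<pi> \<omega>) = Q} =
          V n (card Q) * (\<Prod>A\<in>Q. pochhammer (1 - \<alpha>) (card A - 1)))"

text \<open>A random enumeration \<open>L\<close> of the blocks of the restriction of \<open>\<pi>\<close> to \<open>{1..n}\<close> which,
  conditionally on the whole of \<open>\<pi>\<close>, is uniform among all \<open>fact k\<close> orderings of the \<open>k\<close> blocks.\<close>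

definition exchangeable_random_order ::
  "'a measure \<Rightarrow> ('a \<Rightarrow> nat set set) \<Rightarrow> nat \<Rightarrow> ('a \<Rightarrow> nat set list) \<Rightarrow> bool" where
  "exchangeable_random_order M \<pi> n L \<longleftrightarrow>
     L \<in> measurable M (count_space UNIV) \<and>
     (\<forall>\<omega>\<in>space M. L \<omega> \<in> permutations_of_set (restrict_partition n (\<pi> \<omega>))) \<and>
     (\<forall>E\<in>sets partition_space. \<forall>Q. partition_on {1..n} Q \<longrightarrow>
        (\<forall>l\<in>permutations_of_set Q.
           measure M {\<omega>\<in>space M. \<pi> \<omega> \<in> E \<and> restrict_partition n (\<pi> \<omega>) = Q \<and> L \<omega> = l} =
           measure M {\<omega>\<in>space M. \<pi> \<omega> \<in> E \<and> restrict_partition n (\<pi> \<omega>) = Q} / fact (card Q)))"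

definition num_blocks :: "('a \<Rightarrow> nat set set) \<Rightarrow> nat \<Rightarrow> 'a \<Rightarrow> nat" where
  "num_blocks \<pi> n \<omega> = card (restrict_partition n (\<pi> \<omega>))"

text \<open>The blocks are numbered from 1, hence the shift in the list index; the value is meaningful
  only for \<open>1 \<le> j \<le> length (L \<omega>)\<close>.\<close>

definition block_size :: "('a \<Rightarrow> nat set list) \<Rightarrow> nat \<Rightarrow> 'a \<Rightarrow> nat" where
  "block_size L j \<omega> = card (L \<omega> ! (j - 1))"

end

theory Submission
  imports Defs
begin

text \<open>The event is a finite disjoint union of the events \<open>L = l\<close>, where \<open>l\<close> is an ordered partition of
  \<open>{1..n}\<close> into \<open>k\<close> blocks whose first \<open>r\<close> sizes are prescribed. Each of these has probability
  $\frac{1}{k!} V_{n,k} \prod_{A \in l} (1-\alpha)_{|A|-1}$, which depends on \<open>l\<close> only through its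
  sizes, and the number of ordered partitions with given sizes is a multinomial coefficient.\<close>

section \<open>Counting ordered set partitions with prescribed block sizes\<close>

definition ordered_partitions :: "'a set \<Rightarrow> nat list \<Rightarrow> 'a set list set" where
  "ordered_partitions A ns = {l. distinct l \<and> partition_on A (set l) \<and> map card l = ns}"

lemma finite_ordered_partitions:
  assumes "finite A"
  shows "finite (ordered_partitions A ns)"
proof (rule finite_subset)
  show "ordered_partitions A ns \<subseteq> {l. set l \<subseteq> Pow A \<and> length l = length ns}"
    by (auto simp: ordered_partitions_def partition_on_def)
  show "finite {l. set l \<subseteq> Pow A \<and> length l = length ns}"
    using assms by (intro finite_lists_length_eq) simp
qed

text \<open>The rule \<open>partition_on_insert\<close> asks that \<open>B\<close> be disjoint from
  the union of \<open>P\<close>. Each side of the equivalence supplies this: on the left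
  \<open>B\<close> differs from every member of \<open>P\<close>, so pairwise disjointness applies;
  on the right \<open>P\<close> covers only \<open>A - B\<close>.\<close>

lemma partition_on_insert_iff:
  assumes "B \<notin> P"
  shows "partition_on A (insert B P) \<longleftrightarrow> B \<subseteq> A \<and> B \<noteq> {} \<and> partition_on (A - B) P"
proof -
  have "disjnt B (\<Union>P)" if "partition_on A (insert B P)"
    using that assms by (auto simp: partition_on_def pairwise_insert disjnt_def)
  moreover have "disjnt B (\<Union>P)" if "partition_on (A - B) P"
    using that by (auto simp: partition_on_def disjnt_def)
  ultimately show ?thesis
    using partition_on_insert by blast
qed

text \<open>The recursion behind the count: choose the first block, then order a partition of what
  remains.\<close>

lemma ordered_partitions_Cons:
  assumes "1 \<le> b" "finite A"
  shows "ordered_partitions A (b # ns) =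
    (\<lambda>(B, l). B # l) ` (SIGMA B:{B. B \<subseteq> A \<and> card B = b}. ordered_partitions (A - B) ns)"
proof (intro set_eqI iffI)
  fix l assume l: "l \<in> ordered_partitions A (b # ns)"
  then obtain B l' where "l = B # l'"
    by (auto simp: ordered_partitions_def)
  with l show "l \<in> (\<lambda>(B, l). B # l) `
      (SIGMA B:{B. B \<subseteq> A \<and> card B = b}. ordered_partitions (A - B) ns)"
    by (auto simp: ordered_partitions_def partition_on_insert_iff)
next
  fix l assume "l \<in> (\<lambda>(B, l). B # l) `
      (SIGMA B:{B. B \<subseteq> A \<and> card B = b}. ordered_partitions (A - B) ns)"
  then obtain B l' where l: "l = B # l'" "B \<subseteq> A" "card B = b" "l' \<in> ordered_partitions (A - B) ns"
    by auto
  then have "B \<noteq> {}"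
    using assms by auto
  \<comment> \<open>A nonempty \<open>B\<close> cannot be a block of a partition of
    \<open>A - B\<close>, so prepending it keeps the list distinct.\<close>
  moreover from this have "B \<notin> set l'"
    using l(4) by (auto simp: ordered_partitions_def partition_on_def)
  ultimately show "l \<in> ordered_partitions A (b # ns)"
    using l by (auto simp: ordered_partitions_def partition_on_insert_iff)
qed

text \<open>The multinomial count, stated as a product so that it stays within the natural numbers.
  In the induction there are \<open>card A choose b\<close> first blocks, and each leaves the same
  count for a set of size \<open>card A - b\<close>; the factorials then telescope.\<close>

lemma card_ordered_partitions:
  assumes "finite A" "\<forall>b\<in>set ns. 1 \<le> b" "sum_list ns = card A"
  shows "card (ordered_partitions A ns) * (\<Prod>b\<leftarrow>ns. fact b) = fact (card A)"
  using assms
proof (induction ns arbitrary: A)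
  case Nil
  then have "ordered_partitions A [] = {[]}"
    by (auto simp: ordered_partitions_def partition_on_def)
  with Nil show ?case
    by simp
next
  case (Cons b ns)
  let ?S = "{B. B \<subseteq> A \<and> card B = b}"
  have le: "b \<le> card A"
    using Cons.prems by simp
  have fin: "finite ?S"
    using Cons.prems by simp
  have IH: "card (ordered_partitions (A - B) ns) * (\<Prod>b\<leftarrow>ns. fact b) = fact (card A - b)"
    if "B \<in> ?S" for B
  proof -
    have "card (A - B) = card A - b"
      using that Cons.prems(1) by (metis (lifting) card_Diff_subset finite_subset mem_Collect_eq)
    then show ?thesis
      using Cons.IH[of "A - B"] Cons.prems by simp
  qed
  have "card (ordered_partitions A (b # ns)) = (\<Sum>B\<in>?S. card (ordered_partitions (A - B) ns))"
    using Cons.prems fin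
    \<comment> \<open>Prepending is injective on pairs \<open>(B, l)\<close>, so the cardinality is
      that of the dependent sum.\<close>
    by (subst ordered_partitions_Cons)
       (auto simp: card_image inj_on_def finite_ordered_partitions)
  then have "card (ordered_partitions A (b # ns)) * (\<Prod>b\<leftarrow>ns. fact b) =
      (\<Sum>B\<in>?S. fact (card A - b))"
    using IH by (simp add: sum_distrib_right)
  also have "\<dots> = (card A choose b) * fact (card A - b)"
    using n_subsets[OF Cons.prems(1), of b] by simp
  finally have "card (ordered_partitions A (b # ns)) * (\<Prod>b\<leftarrow>b # ns. fact b) =
      fact b * fact (card A - b) * (card A choose b)"
    by (simp add: mult_ac)
  then show ?case
    using binomial_fact_lemma[OF le] by simp
qed

lemma real_card_ordered_partitions:
  assumes "finite A" "\<forall>b\<in>set ns. 1 \<le> b" "sum_list ns = card A"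
  shows "real (card (ordered_partitions A ns)) = fact (card A) / (\<Prod>b\<leftarrow>ns. fact b)"
proof -
  have "real (\<Prod>b\<leftarrow>ns. fact b) = (\<Prod>b\<leftarrow>ns. fact b)"
    by (induction ns) auto
  then have "real (card (ordered_partitions A ns)) * (\<Prod>b\<leftarrow>ns. fact b) = fact (card A)"
    using card_ordered_partitions[OF assms] by (metis of_nat_fact of_nat_mult)
  moreover have "(\<Prod>b\<leftarrow>ns. fact b) \<noteq> (0 :: real)"
    by (induction ns) auto
  ultimately show ?thesis
    by (simp add: field_simps)
qed

section \<open>Block sizes as compositions\<close>

lemma sum_card_blocks:
  assumes "finite A" "distinct l" "partition_on A (set l)"
  shows "sum_list (map card l) = card A"
proof -
  have "sum_list (map card l) = (\<Sum>B\<in>set l. card B)"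
    using assms by (simp add: sum_list_distinct_conv_sum_set)
  also have "\<dots> = card (\<Union>(set l))"
  proof (rule card_Union_disjoint[symmetric])
    show "pairwise disjnt (set l)"
      using assms(3) by (simp add: partition_on_def)
    show "finite B" if "B \<in> set l" for B
      using assms(1,3) that by (metis Union_upper finite_subset partition_onD1)
  qed
  finally show ?thesis
    using assms by (simp add: partition_on_def)
qed

lemma finite_compositions: "finite (compositions n k)"
proof (rule finite_subset)
  show "compositions n k \<subseteq> {l. set l \<subseteq> {..n} \<and> length l = k}"
    by (auto simp: compositions_def dest: member_le_sum_list)
qed (simp add: finite_lists_length_eq)

lemma map_card_in_compositions:
  assumes "finite A" "distinct l" "partition_on A (set l)"
  shows "map card l \<in> compositions (card A) (length l)"
proof -
  have "1 \<le> card B" if "B \<in> set l" for B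
  proof -
    have "B \<noteq> {}" "B \<subseteq> A"
      using assms(3) that by (auto simp: partition_on_def)
    moreover from this have "finite B"
      using assms(1) by (metis finite_subset)
    ultimately show ?thesis
      by (simp add: Suc_le_eq card_gt_0_iff)
  qed
  then show ?thesis
    using sum_card_blocks[OF assms] by (auto simp: compositions_def)
qed

text \<open>Serves to reindex a sum over all size lists with the prescribed start as a sum over the
  free sizes \<open>bs\<close>; the inverse of prepending \<open>ms\<close> is dropping its length.
  The two upper bounds keep the natural subtractions from truncating.\<close>

lemma compositions_prefix:
  assumes "\<forall>b\<in>set ms. 1 \<le> b" "sum_list ms \<le> n" "length ms \<le> k"
  shows "{ns \<in> compositions n k. take (length ms) ns = ms} =
    (@) ms ` compositions (n - sum_list ms) (k - length ms)"
proof (intro set_eqI iffI)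
  fix ns assume *: "ns \<in> {ns \<in> compositions n k. take (length ms) ns = ms}"
  then have ns: "ns = ms @ drop (length ms) ns"
    by (metis (mono_tags, lifting) append_take_drop_id mem_Collect_eq)
  then have "sum_list ns = sum_list ms + sum_list (drop (length ms) ns)"
    by (metis sum_list_append)
  with * have "drop (length ms) ns \<in> compositions (n - sum_list ms) (k - length ms)"
    by (auto simp: compositions_def dest: in_set_dropD)
  with ns show "ns \<in> (@) ms ` compositions (n - sum_list ms) (k - length ms)"
    by blast
qed (use assms in \<open>auto simp: compositions_def\<close>)

section \<open>The law of the ordered blocks\<close>

lemma partition_on_restrict:
  assumes "partition_on {1..} P"
  shows "partition_on {1..n} (restrict_partition n P)"
proof -
  have "\<Union>(restrict_partition n P) = \<Union>P \<inter> {1..n}"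
    unfolding restrict_partition_def by blast
  then have "\<Union>(restrict_partition n P) = {1..n}"
    using assms by (auto simp: partition_on_def)
  \<comment> \<open>Distinct traces come from distinct blocks of \<open>P\<close>, which are
    disjoint.\<close>
  moreover have "disjoint (restrict_partition n P)"
    using assms unfolding restrict_partition_def partition_on_def disjoint_def by blast
  ultimately show ?thesis
    by (auto simp: partition_on_def restrict_partition_def)
qed

text \<open>The event \<open>L = l\<close> already forces the restriction to be
  \<open>set l\<close>, so uniformity of the order gives it a share
  \<open>1 / fact (length l)\<close> of the Gibbs probability of \<open>set l\<close>.\<close>

lemma prob_ordered_blocks:
  assumes "gibbs_partition M \<alpha> V \<pi>" "1 \<le> n" "exchangeable_random_order M \<pi> n L"
    and "distinct l" "partition_on {1..n} (set l)"
  shows "measure M {\<omega>\<in>space M. L \<omega> = l} =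
    V n (length l) / fact (length l) * (\<Prod>b\<leftarrow>map card l. pochhammer (1 - \<alpha>) (b - 1))"
proof -
  have meas: "\<pi> \<in> measurable M partition_space"
    using assms by (auto simp: gibbs_partition_def exchangeable_partition_def)
  \<comment> \<open>Uniformity of the order is given jointly with any measurable event for
    \<open>\<pi>\<close>; the whole space makes that event vacuous.\<close>
  let ?E = "space partition_space"
  have inE: "\<pi> \<omega> \<in> ?E" if "\<omega> \<in> space M" for \<omega>
    using measurable_space[OF meas that] .
  have L: "L \<omega> \<in> permutations_of_set (restrict_partition n (\<pi> \<omega>))" if "\<omega> \<in> space M" for \<omega>
    using assms that by (auto simp: exchangeable_random_order_def)
  have "?E \<in> sets partition_space"
    by simp
  moreover have "l \<in> permutations_of_set (set l)"
    using assms by (simp add: permutations_of_set_def)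
  ultimately have
    "measure M {\<omega>\<in>space M. \<pi> \<omega> \<in> ?E \<and> restrict_partition n (\<pi> \<omega>) = set l \<and> L \<omega> = l} =
     measure M {\<omega>\<in>space M. \<pi> \<omega> \<in> ?E \<and> restrict_partition n (\<pi> \<omega>) = set l} / fact (card (set l))"
    using assms unfolding exchangeable_random_order_def by blast
  moreover have "{\<omega>\<in>space M. \<pi> \<omega> \<in> ?E \<and> restrict_partition n (\<pi> \<omega>) = set l \<and> L \<omega> = l} =
      {\<omega>\<in>space M. L \<omega> = l}"
  proof -
    have "set (L \<omega>) = restrict_partition n (\<pi> \<omega>)" if "\<omega> \<in> space M" for \<omega>
      using L[OF that] by (simp add: permutations_of_set_def)
    with inE show ?thesis
      by blast
  qed
  moreover have "{\<omega>\<in>space M. \<pi> \<omega> \<in> ?E \<and> restrict_partition n (\<pi> \<omega>) = set l} =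
      {\<omega>\<in>space M. restrict_partition n (\<pi> \<omega>) = set l}"
    using inE by blast
  moreover have "measure M {\<omega>\<in>space M. restrict_partition n (\<pi> \<omega>) = set l} =
      V n (card (set l)) * (\<Prod>A\<in>set l. pochhammer (1 - \<alpha>) (card A - 1))"
    using assms unfolding gibbs_partition_def by blast
  moreover have "(\<Prod>A\<in>set l. pochhammer (1 - \<alpha>) (card A - 1)) =
      (\<Prod>b\<leftarrow>map card l. pochhammer (1 - \<alpha>) (b - 1))"
    using assms by (simp add: prod.distinct_set_conv_list o_def)
  ultimately show ?thesis
    using distinct_card[OF assms(4)] by simp
qed

text \<open>Each summand is a multinomial count times the common probability of all ordered
  partitions with sizes \<open>ms @ bs\<close>.\<close>

lemma prob_block_sizes_prefix:
  assumes "prob_space M" "gibbs_partition M \<alpha> V \<pi>" "1 \<le> n" "exchangeable_random_order M \<pi> n L"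
    and ms: "\<forall>b\<in>set ms. 1 \<le> b" "sum_list ms \<le> n" "length ms \<le> k"
  shows "measure M {\<omega>\<in>space M. take (length ms) (map card (L \<omega>)) = ms \<and> length (L \<omega>) = k} =
    (\<Sum>bs\<in>compositions (n - sum_list ms) (k - length ms).
      fact n / (\<Prod>b\<leftarrow>ms @ bs. fact b) *
      (V n k / fact k * (\<Prod>b\<leftarrow>ms @ bs. pochhammer (1 - \<alpha>) (b - 1))))"
proof -
  interpret prob_space M by fact
  \<comment> \<open>\<open>C\<close> holds the admissible size lists, \<open>T\<close> the ordered
    partitions that realise them, and \<open>w\<close> the probability of one of these in terms of
    its sizes.\<close>
  define C where "C = {ns \<in> compositions n k. take (length ms) ns = ms}"
  define T where "T = (\<Union>ns\<in>C. ordered_partitions {1..n} ns)"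
  define w where "w = (\<lambda>ns. V n k / fact k * (\<Prod>b\<leftarrow>ns. pochhammer (1 - \<alpha>) (b - 1)))"
  have finC: "finite C"
    unfolding C_def using finite_compositions by simp
  then have finT: "finite T"
    unfolding T_def by (simp add: finite_ordered_partitions)
  have LT: "L \<omega> \<in> T \<longleftrightarrow> take (length ms) (map card (L \<omega>)) = ms \<and> length (L \<omega>) = k"
    if "\<omega> \<in> space M" for \<omega>
  proof -
    have "\<pi> \<omega> \<in> space partition_space"
      using assms that
      by (auto simp: gibbs_partition_def exchangeable_partition_def dest: measurable_space)
    then have "partition_on {1..n} (restrict_partition n (\<pi> \<omega>))"
      by (intro partition_on_restrict) (simp add: partition_space_def space_measure_of_conv)
    moreover have "distinct (L \<omega>)" "set (L \<omega>) = restrict_partition n (\<pi> \<omega>)"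
      using assms that by (auto simp: exchangeable_random_order_def permutations_of_set_def)
    ultimately have *: "distinct (L \<omega>)" "partition_on {1..n} (set (L \<omega>))"
      by simp_all
    \<comment> \<open>As \<open>L \<omega>\<close> always lists a partition of
      \<open>{1..n}\<close>, its sizes form a composition of \<open>n\<close>; membership in
      \<open>T\<close> thus tests only the length and the first sizes.\<close>
    have "map card (L \<omega>) \<in> compositions n (length (L \<omega>))"
      using map_card_in_compositions[OF _ *] by simp
    with * show ?thesis
      by (auto simp: T_def C_def ordered_partitions_def compositions_def)
  qed
  have "{\<omega>\<in>space M. take (length ms) (map card (L \<omega>)) = ms \<and> length (L \<omega>) = k} =
      (\<Union>l\<in>T. {\<omega>\<in>space M. L \<omega> = l})"
    using LT by blast
  moreover have "{\<omega>\<in>space M. L \<omega> = l} \<in> sets M" for l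
  proof -
    have "L \<in> measurable M (count_space UNIV)"
      using assms by (simp add: exchangeable_random_order_def)
    then have "L -` {l} \<inter> space M \<in> sets M"
      by (rule measurable_sets) simp
    also have "L -` {l} \<inter> space M = {\<omega>\<in>space M. L \<omega> = l}"
      by auto
    finally show ?thesis .
  qed
  ultimately have
    "measure M {\<omega>\<in>space M. take (length ms) (map card (L \<omega>)) = ms \<and> length (L \<omega>) = k} =
      (\<Sum>l\<in>T. measure M {\<omega>\<in>space M. L \<omega> = l})"
    using finT by (simp, subst finite_measure_finite_Union) (auto simp: disjoint_family_on_def)
  also have "\<dots> = (\<Sum>l\<in>T. w (map card l))"
  proof (rule sum.cong)
    fix l assume "l \<in> T"
    then have "distinct l" "partition_on {1..n} (set l)" "length l = k"
      by (auto simp: T_def C_def ordered_partitions_def compositions_def)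
    then show "measure M {\<omega>\<in>space M. L \<omega> = l} = w (map card l)"
      using prob_ordered_blocks[OF assms(2-4)] by (simp add: w_def)
  qed simp
  also have "\<dots> = (\<Sum>ns\<in>C. \<Sum>l\<in>ordered_partitions {1..n} ns. w (map card l))"
    unfolding T_def using finC
    \<comment> \<open>The families are disjoint for different \<open>ns\<close> because
      \<open>map card\<close> recovers \<open>ns\<close> from a member.\<close>
    by (intro sum.UNION_disjoint) (auto simp: finite_ordered_partitions, auto simp: ordered_partitions_def)
  \<comment> \<open>On each family the summand is the constant \<open>w ns\<close>.\<close>
  also have "\<dots> = (\<Sum>ns\<in>C. real (card (ordered_partitions {1..n} ns)) * w ns)"
    by (simp add: ordered_partitions_def)
  also have "\<dots> = (\<Sum>ns\<in>C. fact n / (\<Prod>b\<leftarrow>ns. fact b) * w ns)"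
    by (intro sum.cong refl, subst real_card_ordered_partitions)
       (auto simp: C_def compositions_def)
  also have "\<dots> = (\<Sum>bs\<in>compositions (n - sum_list ms) (k - length ms).
      fact n / (\<Prod>b\<leftarrow>ms @ bs. fact b) * w (ms @ bs))"
    unfolding C_def compositions_prefix[OF ms] by (subst sum.reindex) (auto simp: inj_on_def)
  finally show ?thesis
    unfolding w_def .
qed

section \<open>The two closed formulas\<close>

lemma falling_of_nat:
  assumes "r \<le> k"
  shows "falling (real k) r = fact k / fact (k - r)"
  using assms
proof (induction r)
  case 0
  then show ?case by (simp add: falling_def)
next
  case (Suc r)
  then have "fact (k - r) = (real k - real r) * (fact (k - Suc r) :: real)"
    by (simp add: fact_reduce[of "k - r"] of_nat_diff)
  moreover have "real k - real r \<noteq> 0"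
    using Suc.prems by simp
  moreover have "falling (real k) (Suc r) = fact k / fact (k - r) * (real k - real r)"
    using Suc by (simp add: falling_def)
  ultimately show ?case
    by simp
qed

theorem proposition1:
  fixes M :: "'a measure" and \<alpha> :: real and V :: "nat \<Rightarrow> nat \<Rightarrow> real"
    and \<pi> :: "'a \<Rightarrow> nat set set" and L :: "'a \<Rightarrow> nat set list"
    and n r k :: nat and m :: "nat \<Rightarrow> nat"
  assumes "prob_space M"
    and "gibbs_partition M \<alpha> V \<pi>"
    and "1 \<le> n"
    and "exchangeable_random_order M \<pi> n L"
    and "1 \<le> r"
    and "\<forall>j\<in>{1..r}. 1 \<le> m j"
    and "0 \<le> int k - int r"
    and "int k - int r \<le> int n - int (\<Sum>j=1..r. m j)"
  shows
    "measure M {\<omega>\<in>space M. (\<forall>j\<in>{1..r}. block_size L j \<omega> = m j) \<and> num_blocks \<pi> n \<omega> = k} =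
       fact n / (\<Prod>j=1..r. fact (m j)) * (\<Prod>j=1..r. pochhammer (1 - \<alpha>) (m j - 1)) *
       (V n k / fact k) *
       (\<Sum>bs\<in>compositions (n - (\<Sum>j=1..r. m j)) (k - r).
          1 / (\<Prod>b\<leftarrow>bs. fact b) * (\<Prod>b\<leftarrow>bs. pochhammer (1 - \<alpha>) (b - 1)))
     \<and>
     measure M {\<omega>\<in>space M. (\<forall>j\<in>{1..r}. block_size L j \<omega> = m j) \<and> num_blocks \<pi> n \<omega> = k} =
       fact n / ((\<Prod>j=1..r. fact (m j)) * fact (n - (\<Sum>j=1..r. m j))) *
       (\<Prod>j=1..r. pochhammer (1 - \<alpha>) (m j - 1)) *
       (V n k / falling (real k) r) *
       gen_stirling \<alpha> (n - (\<Sum>j=1..r. m j)) (k - r)"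
proof -
  define ms where "ms = map m [1..<Suc r]"
  define N where "N = n - (\<Sum>j=1..r. m j)"
  let ?S = "\<Sum>bs\<in>compositions N (k - r).
    1 / (\<Prod>b\<leftarrow>bs. fact b) * (\<Prod>b\<leftarrow>bs. pochhammer (1 - \<alpha>) (b - 1))"
  let ?F = "\<Prod>j=1..r. fact (m j) :: real"
  let ?P = "\<Prod>j=1..r. pochhammer (1 - \<alpha>) (m j - 1)"
  \<comment> \<open>The hypotheses compare integers, so both bounds follow and the natural
    subtractions in the claim are exact.\<close>
  have rk: "r \<le> k" and mn: "(\<Sum>j=1..r. m j) \<le> n"
    using assms(7,8) by linarith+
  have prod_ms: "(\<Prod>b\<leftarrow>ms. f b) = (\<Prod>j=1..r. f (m j))" for f :: "nat \<Rightarrow> real"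
    by (simp add: ms_def prod.distinct_set_conv_list[symmetric] o_def atLeastLessThanSuc_atLeastAtMost
        del: upt_Suc)
  have len: "length ms = r" and sum_ms: "sum_list ms = (\<Sum>j=1..r. m j)"
    by (simp_all add: ms_def interv_sum_list_conv_sum_set_nat atLeastLessThanSuc_atLeastAtMost
        del: upt_Suc)
  have pos: "\<forall>b\<in>set ms. 1 \<le> b"
    using assms(6) by (auto simp: ms_def)
  have event: "(\<forall>j\<in>{1..r}. block_size L j \<omega> = m j) \<and> num_blocks \<pi> n \<omega> = k \<longleftrightarrow>
      take (length ms) (map card (L \<omega>)) = ms \<and> length (L \<omega>) = k" if "\<omega> \<in> space M" for \<omega>
  proof -
    have "distinct (L \<omega>)" "set (L \<omega>) = restrict_partition n (\<pi> \<omega>)"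
      using assms(4) that by (auto simp: exchangeable_random_order_def permutations_of_set_def)
    then have nb: "num_blocks \<pi> n \<omega> = length (L \<omega>)"
      by (metis distinct_card num_blocks_def)
    \<comment> \<open>Blocks are numbered from 1 and list positions from 0; this is only the shift
      \<open>j = Suc i\<close>.\<close>
    have "(\<forall>j\<in>{1..r}. block_size L j \<omega> = m j) \<longleftrightarrow> (\<forall>i<r. card (L \<omega> ! i) = m (Suc i))"
    proof safe
      fix i assume "\<forall>j\<in>{1..r}. block_size L j \<omega> = m j" "i < r"
      then show "card (L \<omega> ! i) = m (Suc i)"
        by (auto simp: block_size_def dest!: bspec[of _ _ "Suc i"])
    next
      fix j assume "\<forall>i<r. card (L \<omega> ! i) = m (Suc i)" "j \<in> {1..r}"
      then show "block_size L j \<omega> = m j"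
        by (auto simp: block_size_def dest!: spec[of _ "j - 1"])
    qed
    \<comment> \<open>Here the length matters: with \<open>r \<le> k\<close> the first
      \<open>r\<close> positions exist, so comparing prefixes is comparing entries.\<close>
    moreover have "take (length ms) (map card (L \<omega>)) = ms \<longleftrightarrow> (\<forall>i<r. card (L \<omega> ! i) = m (Suc i))"
      if "length (L \<omega>) = k"
      using that rk len by (auto simp: list_eq_iff_nth_eq ms_def simp del: upt_Suc)
    ultimately show ?thesis
      unfolding nb by blast
  qed
  let ?pr = "measure M {\<omega>\<in>space M. (\<forall>j\<in>{1..r}. block_size L j \<omega> = m j) \<and> num_blocks \<pi> n \<omega> = k}"
  have "?pr =
      measure M {\<omega>\<in>space M. take (length ms) (map card (L \<omega>)) = ms \<and> length (L \<omega>) = k}"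
    using event by (intro arg_cong[of _ _ "measure M"]) blast
  also have "\<dots> = (\<Sum>bs\<in>compositions N (k - r).
      fact n / (\<Prod>b\<leftarrow>ms @ bs. fact b) *
      (V n k / fact k * (\<Prod>b\<leftarrow>ms @ bs. pochhammer (1 - \<alpha>) (b - 1))))"
    using prob_block_sizes_prefix[OF assms(1-4) pos] rk mn by (simp add: len sum_ms N_def)
  \<comment> \<open>Products over \<open>ms @ bs\<close> split, and the factors from
    \<open>ms\<close> leave the sum.\<close>
  also have "\<dots> = fact n / ?F * ?P * (V n k / fact k) * ?S"
    by (simp add: prod_ms sum_distrib_left sum_divide_distrib mult_ac)
  finally have 1: "?pr = fact n / ?F * ?P * (V n k / fact k) * ?S" .
  have "(\<Prod>b\<leftarrow>bs. pochhammer (1 - \<alpha>) (b - 1) / fact b) =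
      1 / (\<Prod>b\<leftarrow>bs. fact b) * (\<Prod>b\<leftarrow>bs. pochhammer (1 - \<alpha>) (b - 1))" for bs
    by (induction bs) auto
  then have "gen_stirling \<alpha> N (k - r) = fact N / fact (k - r) * ?S"
    by (simp add: gen_stirling_def)
  \<comment> \<open>The factor \<open>fact N\<close> of the Stirling number cancels, and its
    \<open>1 / fact (k - r)\<close> combines with
    \<open>falling (real k) r = fact k / fact (k - r)\<close> to restore
    \<open>1 / fact k\<close>.\<close>
  then have "fact n / ?F * ?P * (V n k / fact k) * ?S =
      fact n / (?F * fact N) * ?P * (V n k / falling (real k) r) * gen_stirling \<alpha> N (k - r)"
    by (simp add: falling_of_nat[OF rk])
  with 1 show ?thesis
    unfolding N_def by simp
qed

end
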